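(* Say that a finite set $S$ of positive integers has property $( * )$ if for each $s \in S$ and each positive integer divisor $d$ of $s$, there exists a unique element $t \in S$ satisfying $\gcd(s,t) = d$ (the elements $s$ and $t$ may be equal). Then, for a nonnegative integer $m$, there exists a finite set $S$ of positive integers with property $( * )$ and exactly $m$ elements if and only if $m = 0$ or $m = 2^k$ for some integer $k \ge 0$.
   Context: The empty set is allowed and satisfies the property vacuously. *)

theory Defs
  imports "HOL-Computational_Algebra.Computational_Algebra"
begin

definition gcd_property :: "nat set \<Rightarrow> bool" where
  "gcd_property S \<longleftrightarrow> (\<forall>s\<in>S. \<forall>d. d dvd s \<longrightarrow> (\<exists>!t. t \<in> S \<and> gcd s t = d))"

end

theory Submission
  imports Defs
begin

text \<open>
  For every \<open>s \<in> S\<close> the map \<open>t \<mapsto> gcd s t\<close> is a bijection from \<open>S\<close> onto the divisors of \<open>s\<close>, and it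
  preserves divisibility by a prime \<open>p\<close> dividing \<open>s\<close>. Hence \<open>|S|\<close> is the number of divisors of \<open>s\<close>,
  and the number of divisors of \<open>s\<close> prime to \<open>p\<close> is the same number \<open>N\<close> for all \<open>s \<in> S\<close> with \<open>p\<close>
  dividing \<open>s\<close>. If \<open>p\<^sup>2\<close> divided \<open>s\<close>, then \<open>|S| \<ge> 3 N\<close>, while the element \<open>t\<close> with \<open>gcd s t = p\<close> is
  exactly divisible by \<open>p\<close>, so \<open>|S| = 2 N\<close>, which is absurd. So \<open>s\<close> is squarefree and its number of
  divisors is a power of two. Conversely, for distinct primes \<open>p\<close> and \<open>q\<close> dividing no element of
  \<open>S\<close>, replacing \<open>S\<close> by \<open>p S \<union> q S\<close> preserves the property and doubles the cardinality.
\<close>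

section \<open>Counting divisors\<close>

lemma coprime_divisors_prime_mult:
  fixes p m :: nat
  assumes "prime p" "\<not> p dvd m"
  shows "{d. d dvd p * m \<and> \<not> p dvd d} = {d. d dvd m}"
proof -
  have "d dvd m" if "d dvd p * m" "\<not> p dvd d" for d
  proof -
    have "coprime d p"
      using prime_imp_coprime[OF assms(1) that(2)] by (simp add: coprime_commute)
    with that show ?thesis
      by (simp add: coprime_dvd_mult_right_iff)
  qed
  moreover have "\<not> p dvd d" if "d dvd m" for d
    using that assms(2) dvd_trans by blast
  ultimately show ?thesis by auto
qed

text \<open>A divisor of \<open>p * m\<close> either is prime to \<open>p\<close>, hence a divisor
  of \<open>m\<close>, or is \<open>p\<close> times a divisor of \<open>m\<close>; the two classes
  are disjoint and equinumerous.\<close>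

lemma card_divisors_prime_mult:
  fixes p m :: nat
  assumes p: "prime p" and pm: "\<not> p dvd m"
  shows "card {d. d dvd p * m} = 2 * card {d. d dvd m}"
proof -
  have m: "m > 0" using pm by (cases m) auto
  have "{d. d dvd p * m} = {d. d dvd p * m \<and> \<not> p dvd d} \<union> (*) p ` {d. d dvd m}"
    using prime_gt_0_nat[OF p] by (auto elim!: dvdE[of p])
  also have "\<dots> = {d. d dvd m} \<union> (*) p ` {d. d dvd m}"
    by (simp add: coprime_divisors_prime_mult[OF assms])
  also have "card \<dots> = card {d. d dvd m} + card ((*) p ` {d. d dvd m})"
    using m pm by (intro card_Un_disjoint) (auto dest: dvd_mult_left)
  also have "card ((*) p ` {d. d dvd m}) = card {d. d dvd m}"
    using prime_gt_0_nat[OF p] by (intro card_image) (auto simp: inj_on_def)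
  finally show ?thesis by simp
qed

text \<open>Prime factors are split off one at a time. Squarefreeness keeps \<open>p\<close> out of
  the cofactor, so each factor doubles the count.\<close>

lemma card_divisors_squarefree:
  fixes n :: nat
  assumes "squarefree n"
  shows "\<exists>k. card {d. d dvd n} = 2 ^ k"
  using assms
proof (induction n rule: less_induct)
  case (less n)
  have n: "n > 0" using less.prems by (cases n) auto
  show ?case
  proof (cases "n = 1")
    case True
    then show ?thesis by (auto intro: exI[of _ 0])
  next
    case False
    then obtain p where p: "prime p" "p dvd n"
      using prime_factor_nat by blast
    then obtain m where m: "n = p * m" by blast
    have "\<not> p dvd m"
      using squarefreeD[OF less.prems, of p] p(1) m by (auto simp: power2_eq_square)
    moreover have "m < n"
      using n m prime_gt_1_nat[OF p(1)] by simp
    moreover have "squarefree m"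
      using squarefree_mono[OF _ less.prems, of m] m by simp
    ultimately show ?thesis
      using less.IH[of m] card_divisors_prime_mult[OF p(1)] m by (metis power_Suc)
  qed
qed

text \<open>Each divisor \<open>d\<close> prime to \<open>p\<close> yields the three divisors
  \<open>d\<close>, \<open>p * d\<close> and \<open>p ^ 2 * d\<close>. No two pairs
  \<open>(i, d)\<close> collide, because \<open>i\<close> is the multiplicity of \<open>p\<close> in
  \<open>p ^ i * d\<close>.\<close>

lemma three_mult_card_le_card_divisors:
  fixes p s :: nat
  assumes p: "prime p" and ps: "p ^ 2 dvd s" and s: "s > 0"
  shows "3 * card {d. d dvd s \<and> \<not> p dvd d} \<le> card {d. d dvd s}"
proof -
  define N where "N = {d. d dvd s \<and> \<not> p dvd d}"
  have p0: "p > 0" using p prime_gt_0_nat by blast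
  have fin: "finite N" unfolding N_def using s by simp
  have sub: "p ^ i * d dvd s" if "d \<in> N" "i \<le> 2" for d i
  proof -
    have "coprime (p ^ 2) d"
      using that p unfolding N_def by (simp add: prime_imp_coprime)
    then have "p ^ 2 * d dvd s"
      using that ps by (simp add: N_def divides_mult)
    then show ?thesis
      using that(2) by (meson dvd_refl dvd_trans le_imp_power_dvd mult_dvd_mono)
  qed
  have inj: "inj_on (\<lambda>(i, d). p ^ i * d) ({..2} \<times> N)"
  proof (rule inj_onI, clarify)
    fix i d j e
    assume A: "i \<le> (2::nat)" "d \<in> N" "j \<le> (2::nat)" "e \<in> N" "p ^ i * d = p ^ j * e"
    have mult: "multiplicity p (p ^ l * c) = l" if "c \<in> N" for l c
      using that p s unfolding N_def
      by (intro multiplicity_eqI)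
         (auto simp: p0 power_Suc2 simp del: power_Suc)
    have "i = j" using mult[OF A(2), of i] mult[OF A(4), of j] A(5) by simp
    then show "i = j \<and> d = e" using A(5) p0 by simp
  qed
  have "3 * card N = card ((\<lambda>(i, d). p ^ i * d) ` ({..2} \<times> N))"
    by (simp add: card_image[OF inj] card_cartesian_product)
  also have "\<dots> \<le> card {d. d dvd s}"
    using s sub by (intro card_mono) auto
  finally show ?thesis unfolding N_def .
qed

section \<open>Elements of a set with the property are squarefree\<close>

lemma gcd_property_bij_betw:
  assumes "gcd_property S" "s \<in> S"
  shows "bij_betw (gcd s) S {d. d dvd s}"
  unfolding bij_betw_def
proof
  have *: "\<exists>!t. t \<in> S \<and> gcd s t = d" if "d dvd s" for d
    using assms that unfolding gcd_property_def by blast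
  show "inj_on (gcd s) S"
    using *[OF gcd_dvd1] unfolding inj_on_def by metis
  show "gcd s ` S = {d. d dvd s}"
    using * by (auto simp: image_iff) metis
qed

text \<open>The right-hand side does not mention \<open>s\<close>, which allows counts for different
  elements divisible by \<open>p\<close> to be compared. The bijection \<open>gcd s\<close>
  restricts because \<open>p\<close> divides \<open>gcd s t\<close> exactly when it divides
  \<open>t\<close>.\<close>

lemma gcd_property_card_coprime_divisors:
  assumes "gcd_property S" "s \<in> S" "p dvd s"
  shows "card {d. d dvd s \<and> \<not> p dvd d} = card {t \<in> S. \<not> p dvd t}"
proof -
  have b: "bij_betw (gcd s) S {d. d dvd s}"
    using gcd_property_bij_betw assms by blast
  then have im: "gcd s ` S = {d. d dvd s}"
    by (simp add: bij_betw_def)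
  have "p dvd gcd s t \<longleftrightarrow> p dvd t" for t
    using assms(3) by simp
  then have "gcd s ` {t \<in> S. \<not> p dvd t} = {d \<in> gcd s ` S. \<not> p dvd d}"
    by blast
  then have "gcd s ` {t \<in> S. \<not> p dvd t} = {d. d dvd s \<and> \<not> p dvd d}"
    by (simp add: im)
  then have "bij_betw (gcd s) {t \<in> S. \<not> p dvd t} {d. d dvd s \<and> \<not> p dvd d}"
    by (intro bij_betw_subset[OF b]) auto
  then show ?thesis by (simp add: bij_betw_same_card)
qed

lemma gcd_property_squarefree:
  assumes S: "gcd_property S" and pos: "\<forall>s\<in>S. s > 0" and s: "s \<in> S"
  shows "squarefree s"
proof (rule ccontr)
  assume "\<not> squarefree s"
  then obtain x where x: "x ^ 2 dvd s" "\<not> x dvd 1"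
    unfolding squarefree_def by blast
  then obtain p where p: "prime p" "p dvd x"
    using prime_factor_nat[of x] by auto
  have p2: "p ^ 2 dvd s"
    using p(2) x(1) dvd_power_same dvd_trans by blast
  then have ps: "p dvd s"
    by (simp add: power2_eq_square dvd_mult_left)
  then obtain t where t: "t \<in> S" "gcd s t = p"
    using S s unfolding gcd_property_def by blast
  then obtain m where m: "t = p * m" using gcd_dvd2 by blast
  \<comment> \<open>Otherwise \<open>p ^ 2\<close> would divide both \<open>s\<close> and
    \<open>t\<close>, hence their gcd \<open>p\<close>.\<close>
  have pm: "\<not> p dvd m"
  proof
    assume "p dvd m"
    then have "p ^ 2 dvd gcd s t"
      using p2 m by (simp add: power2_eq_square)
    then show False
      using t(2) p(1) prime_gt_1_nat[OF p(1)] by (auto dest!: dvd_imp_le simp: power2_eq_square)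
  qed
  define N where "N = card {t \<in> S. \<not> p dvd t}"
  have "card {d. d dvd m} = N"
    using gcd_property_card_coprime_divisors[OF S t(1), of p] m
      coprime_divisors_prime_mult[OF p(1) pm] N_def by simp
  \<comment> \<open>This makes \<open>N\<close> positive, so that \<open>3 * N \<le> 2 * N\<close>
    is absurd.\<close>
  moreover have "m > 0" using pm by (cases m) auto
  then have "card {d. d dvd m} > 0"
    by (auto simp: card_gt_0_iff)
  moreover have "card {d. d dvd t} = 2 * card {d. d dvd m}"
    using card_divisors_prime_mult[OF p(1) pm] m by simp
  moreover have "3 * N \<le> card {d. d dvd s}"
    using three_mult_card_le_card_divisors[OF p(1) p2]
      gcd_property_card_coprime_divisors[OF S s ps] pos s N_def by simp
  moreover have "card {d. d dvd s} = card {d. d dvd t}"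
    using gcd_property_bij_betw[OF S] s t(1) bij_betw_same_card by metis
  ultimately show False by linarith
qed

section \<open>The doubling construction\<close>

lemma gcd_prime_mult_distinct:
  fixes p q s t :: nat
  assumes "prime p" "prime q" "p \<noteq> q" "\<not> q dvd s" "\<not> p dvd t"
  shows "gcd (p * s) (q * t) = gcd s t"
proof -
  \<comment> \<open>Each of the two extra primes is coprime to the other argument, so both cancel
    from the gcd.\<close>
  have "coprime (p * s) q" "coprime t p"
    using assms primes_coprime[of p q] prime_imp_coprime[of q s] prime_imp_coprime[of p t]
    by (auto simp: coprime_commute)
  then show ?thesis
    by (simp only: gcd_mult_right_left_cancel gcd_mult_left_left_cancel)
qed

text \<open>Gcds of \<open>p * s\<close> with elements of \<open>p S\<close> are multiples of
  \<open>p\<close>, those with elements of \<open>q S\<close> are not. So whether \<open>p\<close>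
  divides \<open>d\<close> decides which half contains the witness, and uniqueness within that half
  comes from \<open>S\<close>.\<close>

lemma ex1_gcd_prime_mult:
  fixes p q s d :: nat
  assumes S: "gcd_property S" and s: "s \<in> S"
    and pq: "prime p" "prime q" "p \<noteq> q" and nd: "\<forall>t\<in>S. \<not> p dvd t \<and> \<not> q dvd t"
    and d: "d dvd p * s"
  shows "\<exists>!t. t \<in> (*) p ` S \<union> (*) q ` S \<and> gcd (p * s) t = d"
proof -
  have same: "gcd (p * s) (p * t) = p * gcd s t" for t
    by (simp add: gcd_mult_distrib_nat)
  have other: "gcd (p * s) (q * t) = gcd s t" if "t \<in> S" for t
    using gcd_prime_mult_distinct pq nd s that by blast
  have nds: "\<not> p dvd gcd s t" for t
    using nd s by auto
  have p0: "p > 0" using pq prime_gt_0_nat by blast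
  show ?thesis
  proof (cases "p dvd d")
    case True
    then obtain c where c: "d = p * c" by blast
    with d p0 have "c dvd s" by simp
    then obtain t where t: "t \<in> S" "gcd s t = c" "\<And>u. u \<in> S \<Longrightarrow> gcd s u = c \<Longrightarrow> u = t"
      using S s unfolding gcd_property_def by metis
    show ?thesis
    proof (rule ex1I[of _ "p * t"])
      show "p * t \<in> (*) p ` S \<union> (*) q ` S \<and> gcd (p * s) (p * t) = d"
        using t(1,2) c same by blast
    next
      fix u assume u: "u \<in> (*) p ` S \<union> (*) q ` S \<and> gcd (p * s) u = d"
      have "u \<notin> (*) q ` S"
        using u True nds other by (metis imageE)
      then show "u = p * t"
        using u same t(3) c p0 by auto
    qed
  next
    case False
    then have "d dvd s"
      using d coprime_divisors_prime_mult[OF pq(1), of s] nd s by blast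
    then obtain t where t: "t \<in> S" "gcd s t = d" "\<And>u. u \<in> S \<Longrightarrow> gcd s u = d \<Longrightarrow> u = t"
      using S s unfolding gcd_property_def by metis
    show ?thesis
    proof (rule ex1I[of _ "q * t"])
      show "q * t \<in> (*) p ` S \<union> (*) q ` S \<and> gcd (p * s) (q * t) = d"
        using t(1,2) other by blast
    next
      fix u assume "u \<in> (*) p ` S \<union> (*) q ` S \<and> gcd (p * s) u = d"
      then show "u = q * t"
        using False other same t(3) by auto
    qed
  qed
qed

lemma gcd_property_double:
  assumes S: "gcd_property S" and pq: "prime p" "prime q" "p \<noteq> q"
    and nd: "\<forall>t\<in>S. \<not> p dvd t \<and> \<not> q dvd t"
  shows "gcd_property ((*) p ` S \<union> (*) q ` S)"
proof -
  have "\<exists>!t. t \<in> (*) p ` S \<union> (*) q ` S \<and> gcd (q * s) t = d" if "s \<in> S" "d dvd q * s" for s d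
    \<comment> \<open>The construction is symmetric, so \<open>p\<close> and \<open>q\<close>
      exchange roles here.\<close>
    using ex1_gcd_prime_mult[OF S that(1) pq(2,1) _ _ that(2)] pq(3) nd by (simp add: Un_commute)
  moreover have "\<exists>!t. t \<in> (*) p ` S \<union> (*) q ` S \<and> gcd (p * s) t = d" if "s \<in> S" "d dvd p * s" for s d
    using ex1_gcd_prime_mult[OF S that(1) pq nd that(2)] .
  ultimately show ?thesis
    unfolding gcd_property_def ball_Un ball_simps by simp
qed

lemma card_double:
  fixes p q :: nat
  assumes "finite S" "prime p" "prime q" "p \<noteq> q" "\<forall>t\<in>S. \<not> p dvd t"
  shows "card ((*) p ` S \<union> (*) q ` S) = 2 * card S"
proof -
  \<comment> \<open>Equality would make \<open>p\<close> divide \<open>q\<close> or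
    \<open>t\<close>.\<close>
  have "p * s \<noteq> q * t" if "t \<in> S" for s t
    using assms that by (metis dvd_triv_left prime_dvd_mult_iff primes_dvd_imp_eq)
  then have "(*) p ` S \<inter> (*) q ` S = {}" by blast
  moreover have "inj_on ((*) p) S" "inj_on ((*) q) S"
    using assms(2,3) prime_gt_0_nat by (auto simp: inj_on_def)
  ultimately show ?thesis
    using assms(1) by (simp add: card_Un_disjoint card_image)
qed

lemma gcd_property_exists_power2:
  "\<exists>S :: nat set. finite S \<and> (\<forall>s\<in>S. s > 0) \<and> gcd_property S \<and> card S = 2 ^ k"
proof (induction k)
  case 0
  show ?case
    by (rule exI[of _ "{1}"]) (auto simp: gcd_property_def)
next
  case (Suc k)
  then obtain S :: "nat set"
    where S: "finite S" "\<forall>s\<in>S. s > 0" "gcd_property S" "card S = 2 ^ k"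
    by blast
  \<comment> \<open>Primes larger than the sum exceed every element of \<open>S\<close>, and so
    divide none of these positive numbers.\<close>
  obtain p where p: "prime p" "p > \<Sum>S" using bigger_prime by blast
  obtain q where q: "prime q" "q > p" using bigger_prime by blast
  have nd: "\<forall>t\<in>S. \<not> p dvd t \<and> \<not> q dvd t"
  proof
    fix t assume t: "t \<in> S"
    then have "t \<le> \<Sum>S" using S(1) member_le_sum[of t S "\<lambda>x. x"] by simp
    then show "\<not> p dvd t \<and> \<not> q dvd t"
      using p q t S(2) by (auto dest!: dvd_imp_le)
  qed
  show ?case
  proof (intro exI conjI)
    show "finite ((*) p ` S \<union> (*) q ` S)" using S(1) by simp
    show "\<forall>s\<in>(*) p ` S \<union> (*) q ` S. s > 0"
      using S(2) p q by auto
    show "gcd_property ((*) p ` S \<union> (*) q ` S)"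
      using gcd_property_double[OF S(3) p(1) q(1) _ nd] q(2) by simp
    show "card ((*) p ` S \<union> (*) q ` S) = 2 ^ Suc k"
      using card_double[OF S(1) p(1) q(1)] q(2) nd S(4) by simp
  qed
qed

theorem mainTheorem4:
  fixes m :: nat
  shows "(\<exists>S :: nat set. finite S \<and> (\<forall>s\<in>S. s > 0) \<and> gcd_property S \<and> card S = m)
    \<longleftrightarrow> m = 0 \<or> (\<exists>k :: nat. m = 2 ^ k)"
proof
  assume "\<exists>S :: nat set. finite S \<and> (\<forall>s\<in>S. s > 0) \<and> gcd_property S \<and> card S = m"
  then obtain S :: "nat set"
    where S: "\<forall>s\<in>S. s > 0" "gcd_property S" "card S = m"
    by blast
  show "m = 0 \<or> (\<exists>k. m = 2 ^ k)"
  proof (cases "S = {}")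
    case True
    then show ?thesis using S(3) by simp
  next
    case False
    then obtain s where s: "s \<in> S" by blast
    have "m = card {d. d dvd s}"
      using gcd_property_bij_betw[OF S(2) s] S(3) bij_betw_same_card by blast
    then show ?thesis
      using card_divisors_squarefree[OF gcd_property_squarefree[OF S(2,1) s]] by simp
  qed
next
  assume "m = 0 \<or> (\<exists>k. m = 2 ^ k)"
  moreover have "finite {} \<and> (\<forall>s\<in>{}. s > 0) \<and> gcd_property {} \<and> card {} = (0::nat)"
    by (simp add: gcd_property_def)
  ultimately show "\<exists>S :: nat set. finite S \<and> (\<forall>s\<in>S. s > 0) \<and> gcd_property S \<and> card S = m"
    using gcd_property_exists_power2 by metis
qed

end
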